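(* Let $\mathcal{S}^{d-1}$ denote the unit sphere in $\mathbb{R}^d$. For any $0 < \varepsilon \leq 1$, any integer $k \geq 1$, and any dataset $X \subseteq \mathbb{R}^d$ with $n$ points, there exists a set $\xi \subseteq \mathbb{R}^d$ of size $O\left(\frac{\mathcal{N}(\mathcal{S}^{d-1}, \varepsilon/2) \cdot k \cdot \log n}{\varepsilon}\right)$ such that $\Phi(\xi, X) \leq \varepsilon \cdot \Delta_k(X)$, where $\Phi$ and $\Delta_k$ are the Euclidean $k$-median cost and optimal cost.
   Context: Euclidean $k$-median: for a finite set of centers $C \subseteq \mathbb{R}^d$ and a finite dataset $X \subseteq \mathbb{R}^d$, $\Phi(C, X) = \sum_{x \in X} \min_{c \in C} \|x - c\|$ (unsquared distances), and $\Delta_k(X)$ is the minimum of $\Phi(C, X)$ over all sets $C \subseteq \mathbb{R}^d$ of $k$ centers. For a metric space $(\mathcal{X}, D)$ and $\delta > 0$, a $\delta$-covering set is $S \subseteq \mathcal{X}$ such that every $x \in \mathcal{X}$ has some $s \in S$ with $D(x,s) \leq \delta$; $\mathcal{N}(\mathcal{X}, \delta)$ is the minimum cardinality of such a set. $\mathcal{S}^{d-1}$ carries the Euclidean distance. The big-O hides only a fixed universal constant.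
   Formalization: The factor log n is read as log max(2, n), which is log n for n ≥ 2, because for n = 1 the stated bound is 0 and would force an empty set, whose cost is undefined; the dimension d is taken to be at least 1 so that the unit sphere is nonempty. *)

theory Defs
  imports "HOL-Analysis.Analysis"
begin

text \<open>
  The hidden constant must not depend on the dimension, so the dimension is a natural number
  quantified inside the formula and not a type. As in the library's
  \<^const>\<open>Euclidean_space\<close>, points of \<open>d\<close>-space are functions \<open>x :: nat \<Rightarrow> real\<close> with
  \<open>x i = 0\<close> for all \<open>i \<ge> d\<close>, and \<^term>\<open>nsphere (d - 1)\<close> is the unit sphere in \<open>d\<close>-space (\<open>d \<ge> 1\<close>).
\<close>

abbreviation Rn :: "nat \<Rightarrow> (nat \<Rightarrow> real) set" where
  "Rn d \<equiv> topspace (Euclidean_space d)"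

definition euc_dist :: "nat \<Rightarrow> (nat \<Rightarrow> real) \<Rightarrow> (nat \<Rightarrow> real) \<Rightarrow> real" where
  "euc_dist d x y = L2_set (\<lambda>i. x i - y i) {..<d}"

lemma Metric_space_euc_dist: "Metric_space (Rn d) (euc_dist d)"
proof
  fix x y z :: "nat \<Rightarrow> real"
  show "0 \<le> euc_dist d x y"
    by (simp add: euc_dist_def)
  show "euc_dist d x y = euc_dist d y x"
    by (simp add: euc_dist_def L2_set_def power2_commute)
  show "euc_dist d x y = 0 \<longleftrightarrow> x = y" if "x \<in> Rn d" "y \<in> Rn d"
  proof -
    have "x = y \<longleftrightarrow> (\<forall>i<d. x i = y i)"
      using that by (auto simp: topspace_Euclidean_space fun_eq_iff) (metis not_le)
    then show ?thesis
      by (auto simp: euc_dist_def L2_set_eq_0_iff)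
  qed
  show "euc_dist d x z \<le> euc_dist d x y + euc_dist d y z"
    using L2_set_triangle_ineq[of "\<lambda>i. x i - y i" "\<lambda>i. y i - z i" "{..<d}"]
    by (simp add: euc_dist_def)
qed

lemma topspace_nsphere_euc_dist:
  assumes "d \<ge> 1"
  shows "topspace (nsphere (d - 1)) = {x \<in> Rn d. euc_dist d x (\<lambda>_. 0) = 1}"
proof -
  have "{..d - 1} = {..<d}" "Suc (d - 1) = d"
    using assms by auto
  then show ?thesis
    by (auto simp: nsphere_def euc_dist_def L2_set_def)
qed

text \<open>
  Only finite covering sets are counted, since \<^const>\<open>card\<close> is \<open>0\<close> on infinite sets. The value
  is meaningful when \<open>M\<close> has a finite \<open>\<delta>\<close>-covering set, as the compact sphere does.
\<close>

definition covering_set :: "'a set \<Rightarrow> ('a \<Rightarrow> 'a \<Rightarrow> real) \<Rightarrow> real \<Rightarrow> 'a set \<Rightarrow> bool" where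
  "covering_set M D \<delta> S \<longleftrightarrow> S \<subseteq> M \<and> (\<forall>x\<in>M. \<exists>s\<in>S. D x s \<le> \<delta>)"

definition covering_number :: "'a set \<Rightarrow> ('a \<Rightarrow> 'a \<Rightarrow> real) \<Rightarrow> real \<Rightarrow> nat" where
  "covering_number M D \<delta> = (LEAST m. \<exists>S. finite S \<and> covering_set M D \<delta> S \<and> card S = m)"

text \<open>The cost is meaningful for finite nonempty \<open>C\<close> only.\<close>

definition kmedian_cost :: "nat \<Rightarrow> (nat \<Rightarrow> real) set \<Rightarrow> (nat \<Rightarrow> real) set \<Rightarrow> real" where
  "kmedian_cost d C X = (\<Sum>x\<in>X. Min ((\<lambda>c. euc_dist d x c) ` C))"

text \<open>
  The infimum is over a nonempty set of nonnegative costs if \<open>d, k \<ge> 1\<close>. It is then attained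
  for finite \<open>X\<close>, so it is the minimum.
\<close>

definition kmedian_opt :: "nat \<Rightarrow> nat \<Rightarrow> (nat \<Rightarrow> real) set \<Rightarrow> real" where
  "kmedian_opt d k X = (INF C\<in>{C. C \<subseteq> Rn d \<and> finite C \<and> card C = k}. kmedian_cost d C X)"

text \<open>
  In a size bound of the form \<open>O(\<dots> log n \<dots>)\<close>, \<open>log n\<close> would be \<open>0\<close> for \<open>n = 1\<close> although a
  nonempty set is needed; \<open>n < 2\<close> is read as \<open>n = 2\<close>. For \<open>n \<ge> 2\<close> this is literally \<open>ln n\<close>.
\<close>

definition log_size :: "nat \<Rightarrow> real" where
  "log_size n = ln (real (max 2 n))"

end

theory Submission
  imports Defs
begin

text \<open>
  Take centers \<open>C\<close> whose cost is within a factor \<open>7/5\<close> of the optimum and surround each of them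
  by concentric copies of a minimal \<open>\<epsilon>/2\<close>-covering set of the sphere, with radii
  \<open>r\<^sub>0 (1 + \<epsilon>/8)\<^sup>j\<close> running from \<open>r\<^sub>0 = \<epsilon> \<Delta>\<^sub>k / (8 n)\<close> to \<open>2 \<Delta>\<^sub>k\<close>. A point at distance
  \<open>\<rho>\<close> from its center is then within \<open>(\<epsilon>/2 + \<epsilon>/8) \<rho> + r\<^sub>0\<close> of the new set, and
  these bounds add up to at most \<open>(5/8) \<epsilon> (7/5) \<Delta>\<^sub>k + \<epsilon> \<Delta>\<^sub>k / 8 = \<epsilon> \<Delta>\<^sub>k\<close>.
  The number of radii is of order \<open>ln (n/\<epsilon>) / \<epsilon>\<close>. This is of order \<open>ln n / \<epsilon>\<close> if \<open>\<epsilon> > 1/n\<close>;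
  otherwise, and if \<open>n \<le> k\<close> (where \<open>\<Delta>\<^sub>k\<close> vanishes), the size bound exceeds \<open>n\<close> and
  the dataset itself serves as \<open>\<xi>\<close>.
\<close>

section \<open>Euclidean distance on \<open>d\<close>-space\<close>

lemma Rn_iff: "x \<in> Rn d \<longleftrightarrow> (\<forall>i\<ge>d. x i = 0)"
  by (auto simp: topspace_Euclidean_space)

lemma euc_dist_nonneg [simp]: "0 \<le> euc_dist d x y"
  by (simp add: euc_dist_def)

lemma euc_dist_refl [simp]: "euc_dist d x x = 0"
  by (simp add: euc_dist_def L2_set_def)

lemma euc_dist_commute: "euc_dist d x y = euc_dist d y x"
  by (simp add: euc_dist_def L2_set_def power2_commute)

lemma euc_dist_triangle: "euc_dist d x z \<le> euc_dist d x y + euc_dist d y z"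
  using L2_set_triangle_ineq[of "\<lambda>i. x i - y i" "\<lambda>i. y i - z i" "{..<d}"]
  by (simp add: euc_dist_def)

lemma euc_dist_pos:
  assumes "x \<in> Rn d" "y \<in> Rn d" "x \<noteq> y"
  shows "0 < euc_dist d x y"
  using Metric_space.mdist_pos_less[OF Metric_space_euc_dist] assms by blast

text \<open>Supplies sets of \<open>k\<close> centers for every \<open>k\<close>, so that the
  infimum in \<open>kmedian_opt\<close> is over a nonempty set.\<close>

lemma infinite_Rn:
  assumes "d \<ge> 1"
  shows "infinite (Rn d)"
proof
  assume "finite (Rn d)"
  moreover have "range (\<lambda>t::real. (\<lambda>i::nat. if i = 0 then t else 0)) \<subseteq> Rn d"
    using assms by (auto simp: Rn_iff)
  moreover have "inj (\<lambda>t::real. (\<lambda>i::nat. if i = 0 then t else 0))"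
    by (auto simp: inj_def fun_eq_iff)
  ultimately show False
    using finite_subset finite_imageD infinite_UNIV_char_0 by blast
qed

section \<open>Finite coverings of the sphere\<close>

text \<open>One representative is picked from each of the finitely many fibers of
  \<open>g\<close>.\<close>

lemma finite_covering_set_from_finite_map:
  assumes "finite (g ` M)"
    and "\<And>x y. x \<in> M \<Longrightarrow> y \<in> M \<Longrightarrow> g x = g y \<Longrightarrow> D x y \<le> \<delta>"
  shows "\<exists>S. finite S \<and> covering_set M D \<delta> S"
proof (intro exI conjI)
  show "finite (inv_into M g ` g ` M)"
    using assms(1) by blast
  show "covering_set M D \<delta> (inv_into M g ` g ` M)"
    unfolding covering_set_def
  proof (intro conjI ballI)
    fix x assume "x \<in> M"
    then show "\<exists>s\<in>inv_into M g ` g ` M. D x s \<le> \<delta>"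
      using assms(2)[of x "inv_into M g (g x)"]
      by (auto simp: inv_into_into f_inv_into_f)
  qed (auto intro: inv_into_into)
qed

lemma covering_number_attained:
  assumes "\<exists>S. finite S \<and> covering_set M D \<delta> S"
  obtains S where "finite S" "covering_set M D \<delta> S" "card S = covering_number M D \<delta>"
proof -
  have "\<exists>m S. finite S \<and> covering_set M D \<delta> S \<and> card S = m"
    using assms by blast
  from LeastI_ex[OF this] show thesis
    using that by (auto simp: covering_number_def)
qed

text \<open>Rounding coordinates to a grid of width \<open>1 / m\<close> gives finitely many cells.
  Two points of one cell differ by at most \<open>1 / m\<close> in each coordinate, hence by at most
  \<open>d / m\<close> in distance. Only finiteness matters here: it makes the minimum in
  \<open>covering_number\<close> attained.\<close>

lemma finite_covering_set_sphere:
  assumes "d \<ge> 1" "\<delta> > 0"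
  shows "\<exists>S. finite S \<and> covering_set (topspace (nsphere (d - 1))) (euc_dist d) \<delta> S"
proof -
  let ?M = "topspace (nsphere (d - 1))"
  obtain m :: nat where m: "real d / \<delta> < real m"
    using reals_Archimedean2 by blast
  have m0: "0 < real m"
    using m assms by (smt (verit) divide_nonneg_pos of_nat_0_le_iff)
  \<comment> \<open>\<open>restrict\<close> makes the values extensional, so that the image lies in
    a finite \<open>PiE\<close>.\<close>
  define g :: "(nat \<Rightarrow> real) \<Rightarrow> nat \<Rightarrow> int"
    where "g x = restrict (\<lambda>i. \<lfloor>x i * m\<rfloor>) {..<d}" for x
  have coord: "\<bar>x i\<bar> \<le> 1" if "x \<in> ?M" "i < d" for x i
  proof -
    have "\<bar>x i\<bar> \<le> L2_set (\<lambda>i. \<bar>x i\<bar>) {..<d}"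
      using that by (intro member_le_L2_set) auto
    also have "\<dots> = 1"
      using that topspace_nsphere_euc_dist[OF assms(1)] by (simp add: euc_dist_def L2_set_def)
    finally show ?thesis .
  qed
  have "g ` ?M \<subseteq> PiE {..<d} (\<lambda>_. {- int m..int m})"
  proof
    fix h assume "h \<in> g ` ?M"
    then obtain x where x: "x \<in> ?M" "h = g x" by blast
    have "\<lfloor>x i * m\<rfloor> \<in> {- int m..int m}" if "i < d" for i
    proof -
      have "\<bar>x i * m\<bar> \<le> m"
        using coord[OF x(1) that] m0 by (simp add: abs_mult mult_left_le_one_le)
      then have "- real m \<le> x i * m" "x i * m \<le> m"
        by linarith+
      then show ?thesis
        by (simp add: le_floor_iff floor_le_iff)
    qed
    then show "h \<in> PiE {..<d} (\<lambda>_. {- int m..int m})"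
      using x by (auto simp: g_def)
  qed
  then have fin: "finite (g ` ?M)"
    by (rule finite_subset) (simp add: finite_PiE)
  show ?thesis
  proof (rule finite_covering_set_from_finite_map[OF fin])
    fix x y assume "g x = g y"
    then have fl: "\<lfloor>x i * m\<rfloor> = \<lfloor>y i * m\<rfloor>" if "i < d" for i
      using that by (metis g_def restrict_apply' lessThan_iff)
    have "\<bar>x i - y i\<bar> \<le> 1 / m" if "i < d" for i
    proof -
      have "\<bar>x i * m - y i * m\<bar> \<le> 1"
        using fl[OF that] by linarith
      then have "\<bar>x i - y i\<bar> * m \<le> 1"
        using m0 by (simp add: abs_mult left_diff_distrib[symmetric])
      then show ?thesis
        using m0 by (simp add: pos_le_divide_eq)
    qed
    then have "(\<Sum>i<d. \<bar>x i - y i\<bar>) \<le> (\<Sum>i<d. 1 / m)"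
      by (intro sum_mono) auto
    then have "euc_dist d x y \<le> d / m"
      using L2_set_le_sum_abs[of "\<lambda>i. x i - y i" "{..<d}"] by (simp add: euc_dist_def)
    also have "\<dots> \<le> \<delta>"
      using m m0 assms(2) by (simp add: field_simps)
    finally show "euc_dist d x y \<le> \<delta>" .
  qed
qed

text \<open>Forces covering sets to be nonempty, so the covering number is at least 1. The witness
  is the first basis vector.\<close>

lemma sphere_nonempty:
  assumes "d \<ge> 1"
  shows "topspace (nsphere (d - 1)) \<noteq> {}"
proof -
  have "(\<Sum>i<d. (if i = 0 then 1 else 0 :: real)\<^sup>2) = (\<Sum>i<d. if i = 0 then 1 else 0)"
    by (intro sum.cong) auto
  then have "(\<lambda>i. if i = 0 then 1 else 0) \<in> topspace (nsphere (d - 1))"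
    unfolding topspace_nsphere_euc_dist[OF assms]
    using assms by (auto simp: euc_dist_def L2_set_def Rn_iff)
  then show ?thesis by blast
qed

section \<open>Directions and geometric radii\<close>

lemma euc_dist_normalized:
  assumes "\<rho> = euc_dist d x c" "\<rho> > 0"
  shows "euc_dist d (\<lambda>i. (x i - c i) / \<rho>) (\<lambda>_. 0) = 1"
proof -
  have "L2_set (\<lambda>i. (x i - c i) * (1 / \<rho>)) {..<d} = \<rho> * (1 / \<rho>)"
    using assms(2) by (simp add: L2_set_left_distrib[symmetric] assms(1) euc_dist_def
        del: times_divide_eq_right)
  then show ?thesis
    using assms(2) by (simp add: euc_dist_def)
qed

text \<open>With \<open>u = (x - c) / \<rho>\<close>, the difference \<open>x - (c + r s)\<close>
  splits into an angular part \<open>\<rho> (u - s)\<close> and a radial part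
  \<open>(\<rho> - r) s\<close>, where \<open>s\<close> has norm 1.\<close>

lemma euc_dist_polar:
  assumes "\<rho> > 0" "euc_dist d s (\<lambda>_. 0) = 1"
  shows "euc_dist d x (\<lambda>i. c i + r * s i)
         \<le> \<rho> * euc_dist d (\<lambda>i. (x i - c i) / \<rho>) s + \<bar>\<rho> - r\<bar>"
proof -
  let ?u = "\<lambda>i. (x i - c i) / \<rho> - s i" and ?v = "\<lambda>i. \<bar>\<rho> - r\<bar> * s i"
  have scale: "L2_set (\<lambda>i. (\<rho> - r) * s i) {..<d} = \<bar>\<rho> - r\<bar> * L2_set s {..<d}"
    by (subst L2_set_right_distrib) (auto simp: L2_set_def power_mult_distrib)
  have "x i - (c i + r * s i) = \<rho> * ?u i + (\<rho> - r) * s i" for i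
    using assms(1) by (simp add: field_simps)
  then have "euc_dist d x (\<lambda>i. c i + r * s i) = L2_set (\<lambda>i. \<rho> * ?u i + (\<rho> - r) * s i) {..<d}"
    by (simp add: euc_dist_def)
  also have "\<dots> \<le> L2_set (\<lambda>i. \<rho> * ?u i) {..<d} + L2_set (\<lambda>i. (\<rho> - r) * s i) {..<d}"
    by (rule L2_set_triangle_ineq)
  also have "\<dots> = \<rho> * L2_set ?u {..<d} + \<bar>\<rho> - r\<bar> * L2_set s {..<d}"
    using assms(1) by (simp add: scale L2_set_right_distrib)
  finally show ?thesis
    using assms(2) by (simp add: euc_dist_def)
qed

text \<open>Take the predecessor of the first index at which the radius exceeds
  \<open>\<rho>\<close>; index 0 is not that index because \<open>r \<le> \<rho>\<close>.\<close>

lemma geometric_bracket: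
  fixes q r \<rho> :: real
  assumes "r \<le> \<rho>" "\<rho> < r * q ^ J"
  obtains j where "j < J" "r * q ^ j \<le> \<rho>" "\<rho> < r * q ^ Suc j"
proof -
  have "\<not> \<rho> < r * q ^ 0"
    using assms(1) by simp
  from ex_least_nat_less[of "\<lambda>j. \<rho> < r * q ^ j", OF assms(2) this]
  show thesis
    using that by (metis leI order_refl)
qed

section \<open>Cost and optimal cost\<close>

lemma kmedian_cost_nonneg:
  assumes "finite C" "C \<noteq> {}"
  shows "0 \<le> kmedian_cost d C X"
  unfolding kmedian_cost_def using assms by (intro sum_nonneg) auto

lemma kmedian_cost_self:
  assumes "finite X"
  shows "kmedian_cost d X X = 0"
proof -
  have "Min ((\<lambda>c. euc_dist d x c) ` X) = 0" if "x \<in> X" for x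
    using assms that
    by (intro Min_eqI) (auto intro!: image_eqI[of _ _ x])
  then show ?thesis
    by (simp add: kmedian_cost_def)
qed

lemma nearest_center:
  assumes "finite C" "C \<noteq> {}"
  obtains c where "c \<in> C" "Min ((\<lambda>c. euc_dist d x c) ` C) = euc_dist d x c"
proof -
  have "Min ((\<lambda>c. euc_dist d x c) ` C) \<in> (\<lambda>c. euc_dist d x c) ` C"
    using assms by (intro Min_in) auto
  then show thesis
    using that by blast
qed

lemma kmedian_opt_set_nonempty:
  assumes "d \<ge> 1"
  shows "{C. C \<subseteq> Rn d \<and> finite C \<and> card C = k} \<noteq> {}"
  using infinite_arbitrarily_large[OF infinite_Rn[OF assms], of k] by blast

lemma kmedian_opt_greatest:
  assumes "d \<ge> 1"
    and "\<And>C. C \<subseteq> Rn d \<Longrightarrow> finite C \<Longrightarrow> card C = k \<Longrightarrow> b \<le> kmedian_cost d C X"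
  shows "b \<le> kmedian_opt d k X"
  unfolding kmedian_opt_def
  using kmedian_opt_set_nonempty[OF assms(1)] assms(2) by (intro cINF_greatest) auto

lemma kmedian_opt_nonneg:
  assumes "d \<ge> 1" "k \<ge> 1"
  shows "0 \<le> kmedian_opt d k X"
  using assms by (intro kmedian_opt_greatest kmedian_cost_nonneg) auto

text \<open>Near-optimal centers replace optimal ones, so attainment of the infimum need not be
  proved.\<close>

lemma kmedian_opt_approx:
  assumes "d \<ge> 1" "kmedian_opt d k X < b"
  obtains C where "C \<subseteq> Rn d" "finite C" "card C = k" "kmedian_cost d C X < b"
proof (rule ccontr)
  assume "\<not> thesis"
  then have "b \<le> kmedian_opt d k X"
    by (intro kmedian_opt_greatest[OF assms(1)]) (metis that not_le)
  then show False
    using assms(2) by simp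
qed

text \<open>With fewer centers than points, two points share a nearest center, so every cost is at least
  the least distance between two points.\<close>

lemma kmedian_opt_pos:
  assumes "d \<ge> 1" "k \<ge> 1" "finite X" "X \<subseteq> Rn d" "k < card X"
  shows "0 < kmedian_opt d k X"
proof -
  let ?P = "(\<lambda>(x, y). euc_dist d x y) ` {(x, y) \<in> X \<times> X. x \<noteq> y}"
  have fin: "finite ?P"
    by (rule finite_imageI) (rule finite_subset[of _ "X \<times> X"], use assms in auto)
  have pos: "0 < p" if "p \<in> ?P" for p
    using that assms(4) by (auto intro!: euc_dist_pos)
  \<comment> \<open>The inserted 1 keeps the set nonempty, so \<open>Min\<close> is meaningful
    without a separate argument about \<open>?P\<close>.\<close>
  define \<delta> where "\<delta> = Min (insert 1 ?P)"
  have "0 < \<delta>"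
    using pos fin by (simp add: \<delta>_def)
  also have "\<delta> \<le> kmedian_opt d k X"
  proof (rule kmedian_opt_greatest[OF assms(1)])
    fix C assume C: "C \<subseteq> Rn d" "finite C" "card C = k"
    then have C0: "C \<noteq> {}"
      using assms(2) by auto
    let ?m = "\<lambda>x. Min ((\<lambda>c. euc_dist d x c) ` C)"
    have "\<exists>c. c \<in> C \<and> ?m x = euc_dist d x c" for x
      using nearest_center[OF C(2) C0] by metis
    then obtain f where f: "\<And>x. f x \<in> C" "\<And>x. ?m x = euc_dist d x (f x)"
      by metis
    have "f ` X \<subseteq> C"
      using f by blast
    then have "card (f ` X) < card X"
      using C assms(5) card_mono[of C "f ` X"] by simp
    then have "\<not> inj_on f X"
      by (rule pigeonhole)
    then obtain x y where xy: "x \<in> X" "y \<in> X" "x \<noteq> y" "f x = f y"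
      by (auto simp: inj_on_def)
    have "\<delta> \<le> euc_dist d x y"
      unfolding \<delta>_def using fin xy by (intro Min_le) auto
    also have "\<dots> \<le> euc_dist d x (f x) + euc_dist d y (f x)"
      using euc_dist_triangle[of d x y "f x"] by (simp add: euc_dist_commute)
    also have "\<dots> = (\<Sum>z\<in>{x, y}. ?m z)"
      using xy f(2)[of x] f(2)[of y] by simp
    also have "\<dots> \<le> kmedian_cost d C X"
      unfolding kmedian_cost_def
      using assms(3) xy C(2) C0 by (intro sum_mono2) auto
    finally show "\<delta> \<le> kmedian_cost d C X" .
  qed
  finally show ?thesis .
qed

section \<open>Concentric shells around the centers\<close>

text \<open>Around each center lie \<open>J\<close> copies of \<open>S\<close>, scaled by
  \<open>r * q ^ j\<close>. The centers themselves are kept to serve the points closer than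
  \<open>r\<close>.\<close>

definition shells ::
    "(nat \<Rightarrow> real) set \<Rightarrow> (nat \<Rightarrow> real) set \<Rightarrow> real \<Rightarrow> real \<Rightarrow> nat \<Rightarrow> (nat \<Rightarrow> real) set" where
  "shells C S r q J = C \<union> (\<lambda>(c, j, s) i. c i + r * q ^ j * s i) ` (C \<times> {..<J} \<times> S)"

lemma finite_shells: "finite C \<Longrightarrow> finite S \<Longrightarrow> finite (shells C S r q J)"
  by (simp add: shells_def)

lemma card_shells:
  assumes "finite C" "finite S"
  shows "card (shells C S r q J) \<le> card C * (1 + J * card S)"
proof -
  have "card (shells C S r q J) \<le> card C + card (C \<times> {..<J} \<times> S)"
    unfolding shells_def using assms
    by (intro order_trans[OF card_Un_le] add_left_mono card_image_le) auto
  then show ?thesis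
    by (simp add: card_cartesian_product algebra_simps)
qed

lemma shells_subset_Rn:
  assumes "C \<subseteq> Rn d" "S \<subseteq> Rn d"
  shows "shells C S r q J \<subseteq> Rn d"
proof -
  have "c i + t * s i = 0" if "c \<in> C" "s \<in> S" "i \<ge> d" for c s t i
  proof -
    have "c i = 0" "s i = 0"
      using assms that by (auto simp: Rn_iff subset_iff)
    then show ?thesis by simp
  qed
  then show ?thesis
    using assms(1) by (auto simp: shells_def Rn_iff)
qed

text \<open>If \<open>x\<close> is closer than \<open>r\<close> to \<open>c\<close>, then
  \<open>c\<close> itself will do. Otherwise the covering point nearest to the direction of
  \<open>x - c\<close>, on the largest shell of radius at most the distance to \<open>c\<close>,
  costs \<open>\<delta>\<close> for the angle and \<open>\<eta>\<close> for the radius, both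
  relative to that distance.\<close>

lemma dist_shells:
  assumes d: "d \<ge> 1" and cov: "covering_set (topspace (nsphere (d - 1))) (euc_dist d) \<delta> S"
    and x: "x \<in> Rn d" and C: "C \<subseteq> Rn d" "c \<in> C"
    and r: "r > 0" "\<eta> \<ge> 0" "\<delta> \<ge> 0" and far: "euc_dist d x c < r * (1 + \<eta>) ^ J"
  shows "\<exists>y \<in> shells C S r (1 + \<eta>) J. euc_dist d x y \<le> (\<delta> + \<eta>) * euc_dist d x c + r"
proof -
  define \<rho> where "\<rho> = euc_dist d x c"
  have \<rho>0: "0 \<le> \<rho>"
    by (simp add: \<rho>_def)
  show ?thesis
  proof (cases "\<rho> < r")
    case True
    then have "euc_dist d x c \<le> (\<delta> + \<eta>) * euc_dist d x c + r"
      using r \<rho>0 by (simp add: \<rho>_def add_increasing)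
    then show ?thesis
      using C(2) by (auto simp: shells_def)
  next
    case False
    then have \<rho>: "\<rho> > 0" "r \<le> \<rho>"
      using r by auto
    obtain j where j: "j < J" "r * (1 + \<eta>) ^ j \<le> \<rho>" "\<rho> < r * (1 + \<eta>) ^ Suc j"
      using geometric_bracket[OF \<rho>(2)] far by (auto simp: \<rho>_def)
    let ?u = "\<lambda>i. (x i - c i) / \<rho>" and ?R = "r * (1 + \<eta>) ^ j"
    have sphere: "topspace (nsphere (d - 1)) = {x \<in> Rn d. euc_dist d x (\<lambda>_. 0) = 1}"
      by (rule topspace_nsphere_euc_dist[OF d])
    have "?u \<in> topspace (nsphere (d - 1))"
      unfolding sphere using x C euc_dist_normalized[OF \<rho>_def \<rho>(1)]
      by (auto simp: Rn_iff subset_iff)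
    then obtain s where s: "s \<in> S" "euc_dist d ?u s \<le> \<delta>"
      using cov by (auto simp: covering_set_def)
    have s1: "euc_dist d s (\<lambda>_. 0) = 1"
      using s cov sphere by (auto simp: covering_set_def)
    \<comment> \<open>The bracket says that
      \<open>?R \<le> \<rho> < (1 + \<eta>) * ?R\<close>.\<close>
    have "\<bar>\<rho> - ?R\<bar> \<le> \<eta> * ?R"
      using j by (simp add: algebra_simps)
    also have "\<dots> \<le> \<eta> * \<rho>"
      using j r by (intro mult_left_mono) auto
    finally have "\<bar>\<rho> - ?R\<bar> \<le> \<eta> * \<rho>" .
    moreover have "\<rho> * euc_dist d ?u s \<le> \<rho> * \<delta>"
      using s \<rho> by (intro mult_left_mono) auto
    ultimately have "euc_dist d x (\<lambda>i. c i + ?R * s i) \<le> (\<delta> + \<eta>) * \<rho> + r"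
      using euc_dist_polar[OF \<rho>(1) s1, of x c ?R] r by (simp add: algebra_simps)
    moreover have "(\<lambda>i. c i + ?R * s i) \<in> shells C S r (1 + \<eta>) J"
      unfolding shells_def using C(2) j s by (intro UnI2 image_eqI[of _ _ "(c, j, s)"]) auto
    ultimately show ?thesis
      unfolding \<rho>_def by blast
  qed
qed

text \<open>No single distance exceeds the total cost, so an outermost radius chosen from the cost
  reaches every point. Summing the pointwise bounds adds \<open>r\<close> once per point.\<close>

lemma kmedian_cost_shells:
  assumes d: "d \<ge> 1" and cov: "covering_set (topspace (nsphere (d - 1))) (euc_dist d) \<delta> S"
    and X: "X \<subseteq> Rn d" "finite X" and C: "C \<subseteq> Rn d" "finite C" "C \<noteq> {}" and S: "finite S"
    and r: "r > 0" "\<eta> \<ge> 0" "\<delta> \<ge> 0" and far: "kmedian_cost d C X < r * (1 + \<eta>) ^ J"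
  shows "kmedian_cost d (shells C S r (1 + \<eta>) J) X
         \<le> (\<delta> + \<eta>) * kmedian_cost d C X + real (card X) * r"
proof -
  let ?m = "\<lambda>C x. Min ((\<lambda>c. euc_dist d x c) ` C)"
  have "?m (shells C S r (1 + \<eta>) J) x \<le> (\<delta> + \<eta>) * ?m C x + r" if x: "x \<in> X" for x
  proof -
    obtain c where c: "c \<in> C" "?m C x = euc_dist d x c"
      using nearest_center C by blast
    have "?m C x \<le> kmedian_cost d C X"
      unfolding kmedian_cost_def using X C x by (intro member_le_sum) auto
    then have "euc_dist d x c < r * (1 + \<eta>) ^ J"
      using c far by simp
    then obtain y where y: "y \<in> shells C S r (1 + \<eta>) J"
        "euc_dist d x y \<le> (\<delta> + \<eta>) * euc_dist d x c + r"
      using dist_shells[OF d cov _ C(1) c(1) r, of x J] X x by blast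
    have "?m (shells C S r (1 + \<eta>) J) x \<le> euc_dist d x y"
      using y finite_shells C S by (intro Min_le) auto
    then show ?thesis
      using y c by simp
  qed
  then have "kmedian_cost d (shells C S r (1 + \<eta>) J) X \<le> (\<Sum>x\<in>X. (\<delta> + \<eta>) * ?m C x + r)"
    unfolding kmedian_cost_def by (rule sum_mono)
  also have "\<dots> = (\<delta> + \<eta>) * kmedian_cost d C X + real (card X) * r"
    by (simp add: kmedian_cost_def sum.distrib sum_distrib_left)
  finally show ?thesis .
qed

section \<open>The number of radii\<close>

text \<open>This lower bound, valid even for \<open>n < 2\<close>, lets additive constants be
  absorbed into the logarithm.\<close>

lemma log_size_ge: "2 / 3 \<le> log_size n"
proof -
  have "2 / 3 \<le> ln (2::real)"
    by (rule ln2_ge_two_thirds)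
  also have "\<dots> \<le> log_size n"
    unfolding log_size_def by (subst ln_le_cancel_iff) auto
  finally show ?thesis .
qed

text \<open>As \<open>1 / \<epsilon> < n\<close> and \<open>16 \<le> n ^ 4\<close>, the required
  ratio \<open>16 * n / \<epsilon>\<close> is at most \<open>n ^ 6\<close>. Each factor
  \<open>1 + \<epsilon> / 8\<close> contributes at least \<open>exp (\<epsilon> / 16)\<close>, so
  \<open>6 * 16 = 96\<close> times \<open>ln n / \<epsilon>\<close> factors suffice.\<close>

lemma exists_radius_count:
  assumes "0 < \<epsilon>" "\<epsilon> \<le> (1::real)" "1 < real n * \<epsilon>"
  obtains J where "16 * real n / \<epsilon> \<le> (1 + \<epsilon> / 8) ^ J" "real J + 1 \<le> 100 * log_size n / \<epsilon>"
proof -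
  let ?L = "log_size n"
  define J where "J = nat \<lceil>96 * ?L / \<epsilon>\<rceil>"
  have "0 \<le> 96 * ?L / \<epsilon>"
    using assms log_size_ge[of n] by (intro divide_nonneg_pos) auto
  then have J: "96 * ?L / \<epsilon> \<le> J" "J \<le> 96 * ?L / \<epsilon> + 1"
    unfolding J_def by linarith+
  have "n \<noteq> 0" "n \<noteq> 1"
    using assms(2,3) by (metis mult_zero_left not_one_less_zero of_nat_0,
        metis mult_1 not_less of_nat_1)
  then have n: "2 \<le> n" "?L = ln n"
    by (auto simp: log_size_def max_def)
  have "1 / \<epsilon> \<le> n"
    using assms by (simp add: field_simps)
  then have "16 * real n / \<epsilon> \<le> 16 * real n * real n"
    using mult_left_mono[of "1 / \<epsilon>" "real n" "16 * real n"] by simp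
  also have "\<dots> = 2 ^ 4 * real n ^ 2"
    by (simp add: power2_eq_square)
  also have "\<dots> \<le> real n ^ 4 * real n ^ 2"
    using n by (intro mult_right_mono power_mono) auto
  also have "\<dots> = real n ^ 6"
    by (simp add: power_add[symmetric])
  also have "\<dots> = exp (6 * ?L)"
    using n exp_of_nat_mult[of 6 "ln (real n)"] by simp
  also have "\<dots> \<le> exp (real J * (\<epsilon> / 16))"
    using J(1) assms by (simp add: field_simps)
  also have "\<dots> = exp (\<epsilon> / 16) ^ J"
    by (rule exp_of_nat_mult)
  also have "\<dots> \<le> (1 + \<epsilon> / 8) ^ J"
  proof (rule power_mono)
    have "exp (\<epsilon> / 16) \<le> 1 + \<epsilon> / 16 + (\<epsilon> / 16)\<^sup>2"
      using assms by (intro exp_bound) auto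
    also have "(\<epsilon> / 16)\<^sup>2 \<le> \<epsilon> / 16"
      using assms by (simp add: power2_eq_square mult_left_le)
    finally show "exp (\<epsilon> / 16) \<le> 1 + \<epsilon> / 8"
      by simp
  qed simp
  finally have "16 * real n / \<epsilon> \<le> (1 + \<epsilon> / 8) ^ J" .
  moreover have "real J + 1 \<le> 100 * ?L / \<epsilon>"
  proof -
    \<comment> \<open>The step from 96 to 100 pays for rounding up and for the extra 1 in
      \<open>J + 1\<close>.\<close>
    have "2 * \<epsilon> \<le> 4 * ?L"
      using assms log_size_ge[of n] by linarith
    then have "2 \<le> 4 * ?L / \<epsilon>"
      using assms by (simp add: field_simps)
    moreover have "96 * ?L / \<epsilon> + 4 * ?L / \<epsilon> = 100 * ?L / \<epsilon>"
      by (simp add: add_divide_distrib[symmetric])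
    ultimately show ?thesis
      using J(2) by linarith
  qed
  ultimately show thesis
    by (rule that)
qed

section \<open>The two cases and their combination\<close>

lemma exists_small_cost_set:
  assumes d: "d \<ge> 1" and \<epsilon>: "0 < \<epsilon>" "\<epsilon> \<le> 1" and k: "k \<ge> 1" "k < card X"
    and X: "X \<subseteq> Rn d" "finite X" and n: "1 < real (card X) * \<epsilon>"
    and S: "finite S" "S \<noteq> {}"
      "covering_set (topspace (nsphere (d - 1))) (euc_dist d) (\<epsilon> / 2) S"
  shows "\<exists>\<xi>. \<xi> \<subseteq> Rn d \<and> finite \<xi> \<and> \<xi> \<noteq> {} \<and>
    real (card \<xi>) \<le> 100 * (real (card S) * real k * log_size (card X) / \<epsilon>) \<and>
    kmedian_cost d \<xi> X \<le> \<epsilon> * kmedian_opt d k X"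
proof -
  let ?O = "kmedian_opt d k X" and ?n = "real (card X)"
  have O: "0 < ?O"
    using kmedian_opt_pos d k X by blast
  have n0: "0 < ?n"
    using k by simp
  \<comment> \<open>Strictness requires a positive optimum, which is where \<open>k < card X\<close>
    enters.\<close>
  from O have "?O < 7 / 5 * ?O"
    by simp
  then obtain C where C: "C \<subseteq> Rn d" "finite C" "card C = k" "kmedian_cost d C X < 7 / 5 * ?O"
    by (rule kmedian_opt_approx[OF d])
  have C0: "C \<noteq> {}"
    using C k by auto
  obtain J where J: "16 * ?n / \<epsilon> \<le> (1 + \<epsilon> / 8) ^ J"
      "real J + 1 \<le> 100 * log_size (card X) / \<epsilon>"
    using exists_radius_count[OF \<epsilon> n] by blast
  \<comment> \<open>All \<open>n\<close> additive errors together make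
    \<open>\<epsilon> * ?O / 8\<close>, and \<open>r * (16 * n / \<epsilon>)\<close> is
    \<open>2 * ?O\<close>, beyond the cost of \<open>C\<close>.\<close>
  define r where "r = \<epsilon> * ?O / (8 * ?n)"
  have r: "r > 0"
    using \<epsilon> O n0 by (simp add: r_def)
  have "kmedian_cost d C X < r * (16 * ?n / \<epsilon>)"
    using C(4) O \<epsilon> n0 by (simp add: r_def)
  also have "\<dots> \<le> r * (1 + \<epsilon> / 8) ^ J"
    using J(1) r by (intro mult_left_mono) auto
  finally have far: "kmedian_cost d C X < r * (1 + \<epsilon> / 8) ^ J" .
  let ?\<xi> = "shells C S r (1 + \<epsilon> / 8) J"
  have "kmedian_cost d ?\<xi> X \<le> (\<epsilon> / 2 + \<epsilon> / 8) * kmedian_cost d C X + ?n * r"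
    using kmedian_cost_shells[OF d S(3) X C(1,2) C0 S(1) r _ _ far] \<epsilon> by simp
  also have "\<dots> \<le> (\<epsilon> / 2 + \<epsilon> / 8) * (7 / 5 * ?O) + ?n * r"
    using C(4) \<epsilon> by (intro add_right_mono mult_left_mono) auto
  also have "\<dots> = \<epsilon> * ?O"
    using n0 by (simp add: r_def)
  finally have cost: "kmedian_cost d ?\<xi> X \<le> \<epsilon> * ?O" .
  have S1: "1 \<le> real (card S)"
    using S by (simp add: Suc_le_eq card_gt_0_iff)
  have "real (card ?\<xi>) \<le> real (k * (1 + J * card S))"
    using card_shells[OF C(2) S(1)] C(3) of_nat_le_iff by blast
  \<comment> \<open>Since \<open>S\<close> is nonempty, the centers count as at most one more
    shell.\<close>
  also have "\<dots> \<le> real k * (real (card S) * (real J + 1))"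
    using mult_left_mono[OF S1, of "real k"] by (simp add: algebra_simps)
  also have "\<dots> \<le> real k * (real (card S) * (100 * log_size (card X) / \<epsilon>))"
    using J(2) by (intro mult_left_mono) auto
  finally have "real (card ?\<xi>) \<le> 100 * (real (card S) * real k * log_size (card X) / \<epsilon>)"
    by (simp add: mult_ac)
  moreover have "S \<subseteq> Rn d"
    using S(3) topspace_nsphere_euc_dist[OF d] by (auto simp: covering_set_def)
  then have "?\<xi> \<subseteq> Rn d"
    using shells_subset_Rn C(1) by blast
  moreover have "finite ?\<xi>" "?\<xi> \<noteq> {}"
    using finite_shells C(2) S(1) C0 by (auto simp: shells_def)
  ultimately show ?thesis
    using cost by blast
qed

text \<open>Either alternative in \<open>small\<close> gives
  \<open>card X \<le> k / \<epsilon>\<close>, and the remaining factor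
  \<open>100 * N * log_size (card X)\<close> is at least 1. So the dataset itself fits into the
  bound.\<close>

lemma exists_zero_cost_set:
  assumes d: "d \<ge> 1" and k: "k \<ge> 1" and \<epsilon>: "0 < \<epsilon>" "\<epsilon> \<le> 1" and N: "N \<ge> 1"
    and X: "X \<subseteq> Rn d" "finite X" and small: "card X \<le> k \<or> real (card X) * \<epsilon> \<le> 1"
  shows "\<exists>\<xi>. \<xi> \<subseteq> Rn d \<and> finite \<xi> \<and> \<xi> \<noteq> {} \<and>
    real (card \<xi>) \<le> 100 * (real N * real k * log_size (card X) / \<epsilon>) \<and>
    kmedian_cost d \<xi> X \<le> \<epsilon> * kmedian_opt d k X"
proof -
  obtain \<xi> where \<xi>: "\<xi> \<subseteq> Rn d" "finite \<xi>" "\<xi> \<noteq> {}" "card \<xi> \<le> max 1 (card X)"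
    "kmedian_cost d \<xi> X = 0"
  proof (cases "X = {}")
    case True
    then show thesis
      \<comment> \<open>For empty data the origin serves, since the chosen set has to be
        nonempty.\<close>
      using that[of "{\<lambda>_. 0}"] by (simp add: Rn_iff kmedian_cost_def)
  next
    case False
    then show thesis
      using that[of X] X kmedian_cost_self by simp
  qed
  have k\<epsilon>: "real k \<le> real k / \<epsilon>" "1 / \<epsilon> \<le> real k / \<epsilon>" "1 \<le> real k"
    using k \<epsilon> by (auto simp: field_simps mult_left_le)
  have "real (card X) \<le> real k / \<epsilon>"
    using small
  proof
    assume "real (card X) * \<epsilon> \<le> 1"
    then have "real (card X) \<le> 1 / \<epsilon>"
      using \<epsilon> by (simp add: field_simps)
    then show ?thesis
      using k\<epsilon> by linarith
  qed (use k\<epsilon> in linarith)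
  moreover have "real (card \<xi>) \<le> max 1 (real (card X))"
    using \<xi>(4) by linarith
  ultimately have "real (card \<xi>) \<le> 1 * (real k / \<epsilon>)"
    using k\<epsilon> by linarith
  also have "\<dots> \<le> (100 * (real N * log_size (card X))) * (real k / \<epsilon>)"
  proof (rule mult_right_mono)
    have "1 * (2 / 3) \<le> real N * log_size (card X)"
      using N log_size_ge by (intro mult_mono) auto
    then show "1 \<le> 100 * (real N * log_size (card X))"
      by linarith
  qed (use \<epsilon> in simp)
  finally have "real (card \<xi>) \<le> 100 * (real N * real k * log_size (card X) / \<epsilon>)"
    by (simp add: mult_ac)
  moreover have "0 \<le> \<epsilon> * kmedian_opt d k X"
    using kmedian_opt_nonneg[OF d k] \<epsilon> by simp
  ultimately show ?thesis
    using \<xi> by (intro exI[of _ \<xi>]) simp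
qed

theorem theorem9:
  shows "\<exists>K>0::real. \<forall>(d::nat) (\<epsilon>::real) (k::nat) (n::nat) (X :: (nat \<Rightarrow> real) set).
    d \<ge> 1 \<longrightarrow> 0 < \<epsilon> \<longrightarrow> \<epsilon> \<le> 1 \<longrightarrow> k \<ge> 1 \<longrightarrow>
    X \<subseteq> Rn d \<longrightarrow> finite X \<longrightarrow> card X = n \<longrightarrow>
    (\<exists>\<xi>. \<xi> \<subseteq> Rn d \<and> finite \<xi> \<and> \<xi> \<noteq> {} \<and>
      real (card \<xi>) \<le> K * (real (covering_number (topspace (nsphere (d - 1))) (euc_dist d) (\<epsilon> / 2))
                            * real k * log_size n / \<epsilon>) \<and>
      kmedian_cost d \<xi> X \<le> \<epsilon> * kmedian_opt d k X)"
proof (intro exI[of _ "100::real"] conjI allI impI)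
  fix d :: nat and \<epsilon> :: real and k n :: nat and X :: "(nat \<Rightarrow> real) set"
  assume d: "d \<ge> 1" and \<epsilon>: "0 < \<epsilon>" "\<epsilon> \<le> 1" and k: "k \<ge> 1"
    and X: "X \<subseteq> Rn d" "finite X" and n: "card X = n"
  let ?M = "topspace (nsphere (d - 1))"
  let ?N = "covering_number ?M (euc_dist d) (\<epsilon> / 2)"
  have "\<epsilon> / 2 > 0"
    using \<epsilon> by simp
  then obtain S where S: "finite S" "covering_set ?M (euc_dist d) (\<epsilon> / 2) S" "card S = ?N"
    using covering_number_attained[OF finite_covering_set_sphere[OF d]] by blast
  have S0: "S \<noteq> {}"
    using S(2) sphere_nonempty[OF d] by (auto simp: covering_set_def)
  then have N: "?N \<ge> 1"
    using S by (metis One_nat_def Suc_leI card_gt_0_iff)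
  show "\<exists>\<xi>. \<xi> \<subseteq> Rn d \<and> finite \<xi> \<and> \<xi> \<noteq> {} \<and>
      real (card \<xi>) \<le> 100 * (real ?N * real k * log_size n / \<epsilon>) \<and>
      kmedian_cost d \<xi> X \<le> \<epsilon> * kmedian_opt d k X"
  \<comment> \<open>The negation yields both needs of the shells: a positive optimum from
    \<open>k < n\<close>, and \<open>1 / \<epsilon> < n\<close>, which bounds the number of radii by
    a multiple of \<open>ln n / \<epsilon>\<close>.\<close>
  proof (cases "card X \<le> k \<or> real (card X) * \<epsilon> \<le> 1")
    case True
    then show ?thesis
      using exists_zero_cost_set[OF d k \<epsilon> N X] n by simp
  next
    case False
    then show ?thesis
      using exists_small_cost_set[OF d \<epsilon> k _ X _ S(1) S0 S(2)] n S(3) by simp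
  qed
qed simp

end
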